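(* Let $a,b$ be positive integers, and let $\sigma$ be a configuration for parallel chip-firing on the complete bipartite graph $K_{a,b}$. Let $|\sigma|=\sum_v\sigma(v)$ denote its total number of chips. If $$2ab-a-b<|\sigma|<2ab,$$ then the eventual period of $\sigma$ is $2$.
   Context: $K_{a,b}$ is the complete bipartite graph with sides $L=\{L_1,\dots,L_a\}$ and $R=\{R_1,\dots,R_b\}$, so vertices of $L$ have degree $b$ and vertices of $R$ have degree $a$. A configuration is a function $\sigma$ from the vertex set to the nonnegative integers ($\sigma(v)$ is the number of chips at $v$). In one round of parallel chip-firing, every vertex $v$ with $\sigma(v)\ge\deg(v)$ fires, all simultaneously: each firing vertex sends one chip to each of its neighbors. Thus the updated configuration is $U\sigma(v)=\sigma(v)-\deg(v)\,F(v)+\sum_{w\sim v}F(w)$, where $F(v)=1$ if $\sigma(v)\ge\deg(v)$ and $F(v)=0$ otherwise. The sequence $\sigma,U\sigma,U^2\sigma,\dots$ is eventually periodic; the eventual period of $\sigma$ is the least integer $p\ge1$ such that $U^{t+p}\sigma=U^t\sigma$ for all sufficiently large $t$. *)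

theory Defs
  imports Complex_Main
begin

(* A graph is given by its symmetric adjacency relation; a configuration assigns
   a number of chips to every element of the vertex type. *)

type_synonym 'v config = "'v \<Rightarrow> nat"

definition deg :: "('v \<times> 'v) set \<Rightarrow> 'v \<Rightarrow> nat" where
  "deg E v = card (E `` {v})"

definition fires :: "('v \<times> 'v) set \<Rightarrow> 'v config \<Rightarrow> 'v \<Rightarrow> nat" where
  "fires E \<sigma> v = (if \<sigma> v \<ge> deg E v then 1 else 0)"

(* The natural-number subtraction never truncates: a vertex fires only if it has
   at least its degree many chips. *)

definition chip_step :: "('v \<times> 'v) set \<Rightarrow> 'v config \<Rightarrow> 'v config" where
  "chip_step E \<sigma> v = \<sigma> v - deg E v * fires E \<sigma> v + (\<Sum>w \<in> E `` {v}. fires E \<sigma> w)"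

definition eventual_period :: "('v \<times> 'v) set \<Rightarrow> 'v config \<Rightarrow> nat" where
  "eventual_period E \<sigma> = (LEAST p. p \<ge> 1 \<and>
     (\<forall>\<^sub>F t in sequentially. (chip_step E ^^ (t + p)) \<sigma> = (chip_step E ^^ t) \<sigma>))"

definition K_verts :: "nat \<Rightarrow> nat \<Rightarrow> (nat + nat) set" where
  "K_verts a b = {1..a} <+> {1..b}"

definition K_edges :: "nat \<Rightarrow> nat \<Rightarrow> ((nat + nat) \<times> (nat + nat)) set" where
  "K_edges a b = (Inl ` {1..a} \<times> Inr ` {1..b}) \<union> (Inr ` {1..b} \<times> Inl ` {1..a})"

definition total_chips :: "'v set \<Rightarrow> 'v config \<Rightarrow> nat" where
  "total_chips V \<sigma> = (\<Sum>v\<in>V. \<sigma> v)"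

lemma deg_K_Inl: "i \<in> {1..a} \<Longrightarrow> deg (K_edges a b) (Inl i) = b"
proof -
  assume "i \<in> {1..a}"
  then have "K_edges a b `` {Inl i} = Inr ` {1..b}"
    by (auto simp: K_edges_def)
  then show ?thesis by (simp add: deg_def card_image)
qed

lemma deg_K_Inr: "j \<in> {1..b} \<Longrightarrow> deg (K_edges a b) (Inr j) = a"
proof -
  assume "j \<in> {1..b}"
  then have "K_edges a b `` {Inr j} = Inl ` {1..a}"
    by (auto simp: K_edges_def)
  then show ?thesis by (simp add: deg_def card_image)
qed

(* Values of a configuration outside the vertex set never change and never
   influence the vertices, so comparing configurations as total functions in
   eventual_period amounts to comparing them on the vertex set. *)

lemma chip_step_K_outside:
  assumes "v \<notin> K_verts a b"
  shows "chip_step (K_edges a b) \<sigma> v = \<sigma> v"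
proof -
  have "K_edges a b `` {v} = {}"
    using assms by (auto simp: K_edges_def K_verts_def)
  then show ?thesis by (simp add: chip_step_def deg_def)
qed

lemma chip_step_K_cong:
  assumes "\<And>w. w \<in> K_verts a b \<Longrightarrow> \<sigma> w = \<tau> w" and "v \<in> K_verts a b"
  shows "chip_step (K_edges a b) \<sigma> v = chip_step (K_edges a b) \<tau> v"
proof -
  have "K_edges a b `` {v} \<subseteq> K_verts a b"
    by (auto simp: K_edges_def K_verts_def)
  then have "fires (K_edges a b) \<sigma> w = fires (K_edges a b) \<tau> w"
    if "w \<in> K_edges a b `` {v}" for w
    using assms(1) that by (auto simp: fires_def)
  then show ?thesis
    using assms by (simp add: chip_step_def fires_def)
qed

end

theory Submission
  imports Defs
begin

text \<open>
  Once every vertex holds fewer than twice its degree many chips, the number of firings of a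
  vertex is a floor function of the number of chips it has received. So if \<open>A t\<close> and \<open>B t\<close>
  count the firings on the right and on the left before time \<open>t\<close>, then \<open>B (t + 1) = f (A t)\<close> and
  \<open>A (t + 1) = g (B t)\<close>, where \<open>f\<close> and \<open>g\<close> are monotone, \<open>f (x + b) = f x + a\<close> and
  \<open>g (y + a) = g y + b\<close>. By Hermite's identity, the sum of \<open>f\<close> over one period plus the
  sum of \<open>g\<close> over one period is the number of chips. If \<open>g (f x) > x + b\<close> for all \<open>x\<close>, this number
  is at least \<open>2ab\<close>; if \<open>g (f x) < x + b\<close> for all \<open>x\<close>, it is at most \<open>2ab - a - b\<close>. In between,
  the degree one map \<open>g \<circ> f\<close> moves some point by exactly \<open>b\<close>, so all its orbits eventually move by
  exactly \<open>b\<close>, that is, every vertex fires exactly once in any two consecutive rounds.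
\<close>

section \<open>Monotone maps commuting with a translation\<close>

text \<open>Hermite's identity in integer form. Raising \<open>s\<close> by one slides the window of
  \<open>b\<close> consecutive arguments: \<open>s div b\<close> leaves and
  \<open>(s + b) div b\<close>, which is larger by one, enters.\<close>

lemma sum_div_shift_eq:
  fixes s b :: nat
  assumes "b \<ge> 1"
  shows "(\<Sum>x<b. (s + x) div b) = s"
proof (induction s)
  case 0
  then show ?case by simp
next
  case (Suc s)
  have "s div b + (\<Sum>x<b. (Suc s + x) div b) = (\<Sum>x<Suc b. (s + x) div b)"
    by (subst sum.lessThan_Suc_shift) simp
  also have "\<dots> = s + (s div b + 1)"
    using Suc assms by simp
  finally show ?case by simp
qed

lemma sum_window_shift:
  fixes g :: "nat \<Rightarrow> nat"
  assumes "\<And>y. g (y + a) = g y + b"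
  shows "(\<Sum>y=c..<c+a. g y) = (\<Sum>y<a. g y) + c * b"
proof (induction c)
  case 0
  then show ?case by (simp add: lessThan_atLeast0)
next
  case (Suc c)
  have "g c + (\<Sum>y=Suc c..<Suc c + a. g y) = (\<Sum>y=c..<c+a. g y) + g (c + a)"
  proof -
    have "g c + (\<Sum>y=Suc c..<Suc c + a. g y) = (\<Sum>y=c..<Suc (c + a). g y)"
      by (subst sum.atLeast_Suc_lessThan[of c]) auto
    then show ?thesis by simp
  qed
  with Suc assms[of c] show ?case by simp
qed

text \<open>Abel summation. The offset \<open>c\<close> is \<open>b\<close> in the lower bound below
  and \<open>b - 1\<close> in the upper bound.\<close>

lemma sum_increments_by_parts:
  fixes f :: "nat \<Rightarrow> int"
  shows "(\<Sum>k<n. (f (Suc k) - f k) * (int k + c + 1)) = f n * (int n + c) - f 0 * c - (\<Sum>k<n. f k)"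
  by (induction n) (simp_all add: algebra_simps)

text \<open>In the next two bounds, \<open>g\<close> is summed over the window from \<open>f 0\<close> to \<open>f b = f 0 + a\<close>, cut at
  the values \<open>f k\<close>: between \<open>f k\<close> and \<open>f (k + 1)\<close> monotonicity compares \<open>g\<close> with \<open>k + b + 1\<close>
  or \<open>k + b\<close>, and summation by parts brings in the sum of \<open>f\<close>.\<close>

lemma translation_lower_bound:
  fixes f g :: "nat \<Rightarrow> nat"
  assumes mf: "mono f" and mg: "mono g"
    and pf: "\<And>x. f (x + b) = f x + a" and pg: "\<And>y. g (y + a) = g y + b"
    and h: "\<And>x. g (f x) > x + b"
  shows "2 * a * b \<le> (\<Sum>x<b. f x) + (\<Sum>y<a. g y)"
proof -
  have step: "(\<Sum>k<n. (int (f (Suc k)) - int (f k)) * (int k + int b + 1)) \<le> int (\<Sum>y=f 0..<f n. g y)" for n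
  proof (induction n)
    case 0
    then show ?case by simp
  next
    case (Suc n)
    have le: "f 0 \<le> f n" "f n \<le> f (Suc n)"
      using mf by (auto simp: mono_def)
    have "(f (Suc n) - f n) * (n + b + 1) = (\<Sum>y=f n..<f (Suc n). n + b + 1)"
      by simp
    also have "\<dots> \<le> (\<Sum>y=f n..<f (Suc n). g y)"
    proof (rule sum_mono)
      fix y assume "y \<in> {f n..<f (Suc n)}"
      then have "g (f n) \<le> g y" using mg by (simp add: mono_def)
      then show "n + b + 1 \<le> g y" using h[of n] by simp
    qed
    finally have "int ((f (Suc n) - f n) * (n + b + 1)) \<le> int (\<Sum>y=f n..<f (Suc n). g y)"
      by (simp only: of_nat_le_iff)
    then have "(int (f (Suc n)) - int (f n)) * (int n + int b + 1) \<le> int (\<Sum>y=f n..<f (Suc n). g y)"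
      using le by (simp only: of_nat_mult of_nat_diff of_nat_add of_nat_1)
    moreover have "(\<Sum>y=f 0..<f (Suc n). g y) = (\<Sum>y=f 0..<f n. g y) + (\<Sum>y=f n..<f (Suc n). g y)"
      using le by (simp add: sum.atLeastLessThan_concat)
    ultimately show ?case
      using Suc unfolding sum.lessThan_Suc by linarith
  qed
  have "f b = f 0 + a" using pf[of 0] by simp
  then have "(\<Sum>y=f 0..<f b. g y) = (\<Sum>y<a. g y) + f 0 * b"
    using sum_window_shift[of g a b, OF pg] by simp
  then have "int (f b) * (int b + int b) - int (f 0) * int b - (\<Sum>k<b. int (f k)) \<le> int ((\<Sum>y<a. g y) + f 0 * b)"
    using step[of b] sum_increments_by_parts[of "\<lambda>k. int (f k)" "int b" b] by linarith
  then have "int (2 * a * b) \<le> int ((\<Sum>x<b. f x) + (\<Sum>y<a. g y))"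
    using \<open>f b = f 0 + a\<close> by (simp add: algebra_simps)
  then show ?thesis by linarith
qed

lemma translation_upper_bound:
  fixes f g :: "nat \<Rightarrow> nat"
  assumes mf: "mono f" and mg: "mono g"
    and pf: "\<And>x. f (x + b) = f x + a" and pg: "\<And>y. g (y + a) = g y + b"
    and h: "\<And>x. g (f x) < x + b"
  shows "(\<Sum>x<b. f x) + (\<Sum>y<a. g y) + a + b \<le> 2 * a * b"
proof -
  \<comment> \<open>An upper bound on \<open>g y\<close> comes from the right end of each piece, so
    the pieces are open on the left and closed on the right. Shifting the window by one yields the
    term \<open>b\<close> of the conclusion; weights smaller by one than in the lower bound yield
    the term \<open>a\<close>.\<close>
  have step: "int (\<Sum>y=Suc (f 0)..<Suc (f n). g y) \<le> (\<Sum>k<n. (int (f (Suc k)) - int (f k)) * (int k + (int b - 1) + 1))" for n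
  proof (induction n)
    case 0
    then show ?case by simp
  next
    case (Suc n)
    have le: "f 0 \<le> f n" "f n \<le> f (Suc n)"
      using mf by (auto simp: mono_def)
    have "(\<Sum>y=Suc (f n)..<Suc (f (Suc n)). g y) \<le> (\<Sum>y=Suc (f n)..<Suc (f (Suc n)). n + b)"
    proof (rule sum_mono)
      fix y assume "y \<in> {Suc (f n)..<Suc (f (Suc n))}"
      then have "g y \<le> g (f (Suc n))" using mg by (simp add: mono_def)
      then show "g y \<le> n + b" using h[of "Suc n"] by simp
    qed
    also have "\<dots> = (f (Suc n) - f n) * (n + b)"
      by simp
    finally have "int (\<Sum>y=Suc (f n)..<Suc (f (Suc n)). g y) \<le> int ((f (Suc n) - f n) * (n + b))"
      by (simp only: of_nat_le_iff)
    then have "int (\<Sum>y=Suc (f n)..<Suc (f (Suc n)). g y)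
        \<le> (int (f (Suc n)) - int (f n)) * (int n + (int b - 1) + 1)"
      using le by (simp only: of_nat_mult of_nat_diff of_nat_add) simp
    moreover have "(\<Sum>y=Suc (f 0)..<Suc (f (Suc n)). g y)
        = (\<Sum>y=Suc (f 0)..<Suc (f n). g y) + (\<Sum>y=Suc (f n)..<Suc (f (Suc n)). g y)"
      using le by (simp only: sum.atLeastLessThan_concat Suc_le_mono)
    ultimately show ?case
      using Suc unfolding sum.lessThan_Suc by linarith
  qed
  have "f b = f 0 + a" using pf[of 0] by simp
  then have "(\<Sum>y=Suc (f 0)..<Suc (f b). g y) = (\<Sum>y<a. g y) + Suc (f 0) * b"
    using sum_window_shift[of g a b "Suc (f 0)", OF pg] by simp
  then have "int ((\<Sum>y<a. g y) + Suc (f 0) * b)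
      \<le> int (f b) * (int b + (int b - 1)) - int (f 0) * (int b - 1) - (\<Sum>k<b. int (f k))"
    using step[of b] sum_increments_by_parts[of "\<lambda>k. int (f k)" "int b - 1" b] by linarith
  then have "int ((\<Sum>x<b. f x) + (\<Sum>y<a. g y) + a + b) \<le> int (2 * a * b)"
    using \<open>f b = f 0 + a\<close> by (simp add: algebra_simps)
  then show ?thesis by linarith
qed

text \<open>If no point moves by exactly \<open>b\<close>, a move by more than \<open>b\<close> at
  \<open>x\<close> forces one at \<open>x + 1\<close>, since
  \<open>h (x + 1) \<ge> h x \<ge> x + 1 + b\<close> and equality is excluded. Periodicity ties the
  behaviour at every multiple of \<open>b\<close> to that at 0.\<close>

lemma translation_trichotomy:
  fixes h :: "nat \<Rightarrow> nat"
  assumes mh: "mono h" and ph: "\<And>x. h (x + b) = h x + b" and "b \<ge> 1"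
  obtains z where "h z = z + b" | "\<And>x. h x > x + b" | "\<And>x. h x < x + b"
proof (cases "\<exists>z. h z = z + b")
  case True
  then show ?thesis using that(1) by blast
next
  case False
  have up: "h (x + k) > x + k + b" if "h x > x + b" for x k
  proof (induction k)
    case 0
    then show ?case using that by simp
  next
    case (Suc k)
    have "h (x + k) \<le> h (x + Suc k)" using mh by (simp add: mono_def)
    then show ?case using Suc False[simplified, rule_format, of "x + Suc k"] by simp
  qed
  have mult: "h (k * b) = h 0 + k * b" for k
  proof (induction k)
    case (Suc k)
    then show ?case using ph[of "k * b"] by (simp add: algebra_simps)
  qed simp
  show ?thesis
  proof (cases "h 0 > b")
    case True
    then show ?thesis using up[of 0] that(2) by simp
  next
    case nle: False
    have "h x < x + b" for x
    proof (rule ccontr)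
      assume "\<not> h x < x + b"
      then have "h x > x + b" using False by (metis linorder_neqE_nat)
      \<comment> \<open>\<open>x * b\<close> is a multiple of \<open>b\<close> not before
        \<open>x\<close>, so the excess reaches it and contradicts the behaviour at 0.\<close>
      moreover have "x \<le> x * b" using \<open>b \<ge> 1\<close> by simp
      ultimately have "h (x * b) > x * b + b"
        using up[of x "x * b - x"] by simp
      then show False using mult[of x] nle by simp
    qed
    then show ?thesis using that(3) by blast
  qed
qed

text \<open>If no step equals \<open>b\<close>, monotonicity keeps all steps on the same side of
  \<open>b\<close>, so after \<open>n\<close> steps the orbit has drifted by at least
  \<open>n\<close> from uniform motion at speed \<open>b\<close>. Translates of \<open>z\<close>
  move at exactly that speed and the orbit cannot cross them, so the drift is bounded.\<close>

lemma translation_orbit_locks: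
  fixes h x :: "nat \<Rightarrow> nat"
  assumes mh: "mono h" and ph: "\<And>x. h (x + b) = h x + b" and "b \<ge> 1"
    and z: "h z = z + b" and x: "\<And>n. x (Suc n) = h (x n)"
  obtains n where "x (Suc n) = x n + b"
proof (rule ccontr)
  assume "\<not> thesis"
  with that have ne: "x (Suc n) \<noteq> x n + b" for n by blast
  have mult: "h (w + k * b) = h w + k * b" for w k
  proof (induction k)
    case (Suc k)
    then show ?case using ph[of "w + k * b"] by (simp add: algebra_simps)
  qed simp
  have self_le: "c \<le> c * b" for c using \<open>b \<ge> 1\<close> by simp
  show False
  proof (cases "x (Suc 0) > x 0 + b")
    case True
    have inc: "x (Suc n) > x n + b" for n
    proof (induction n)
      case (Suc n)
      then have "h (x n + b) \<le> h (x (Suc n))" using mh by (simp add: mono_def)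
      then show ?case using ph[of "x n"] x[of n] x[of "Suc n"] ne[of "Suc n"] by simp
    qed (use True in simp)
    have lo: "x 0 + n * b + n \<le> x n" for n
    proof (induction n)
      case (Suc n)
      then show ?case using inc[of n] by simp
    qed simp
    have hi: "x n \<le> z + (x 0 + n) * b" for n
    proof (induction n)
      case (Suc n)
      then have "h (x n) \<le> h (z + (x 0 + n) * b)" using mh by (simp add: mono_def)
      then show ?case using mult[of z "x 0 + n"] z x[of n] by (simp add: algebra_simps)
    qed (use self_le[of "x 0"] in \<open>simp add: trans_le_add2\<close>)
    show False
      using lo[of "Suc (z + x 0 * b)"] hi[of "Suc (z + x 0 * b)"] by (simp add: algebra_simps)
  next
    case False
    have dec: "x (Suc n) < x n + b" for n
    proof (induction n)
      case (Suc n)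
      then have "h (x (Suc n)) \<le> h (x n + b)" using mh by (simp add: mono_def)
      then show ?case using ph[of "x n"] x[of n] x[of "Suc n"] ne[of "Suc n"] by simp
    qed (use False ne[of 0] in simp)
    have hi: "x n + n \<le> x 0 + n * b" for n
    proof (induction n)
      case (Suc n)
      then show ?case using dec[of n] by simp
    qed simp
    \<comment> \<open>The orbit is lifted by \<open>z * b\<close> to start above \<open>z\<close>,
      which avoids a negative translate of \<open>z\<close>.\<close>
    have lo: "z + n * b \<le> x n + z * b" for n
    proof (induction n)
      case (Suc n)
      then have "h (z + n * b) \<le> h (x n + z * b)" using mh by (simp add: mono_def)
      then show ?case using mult[of z n] mult[of "x n" z] z x[of n] by (simp add: algebra_simps)
    qed (use self_le[of z] in \<open>simp add: trans_le_add2\<close>)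
    show False
      using lo[of "Suc (x 0 + z * b)"] hi[of "Suc (x 0 + z * b)"] by (simp add: algebra_simps)
  qed
qed

section \<open>Parallel chip-firing\<close>

lemma fires_le_1: "fires E \<sigma> v \<le> 1"
  by (simp add: fires_def)

lemma sum_fires_le_deg: "(\<Sum>w\<in>E `` {v}. fires E \<sigma> w) \<le> deg E v"
  using sum_mono[of "E `` {v}" "fires E \<sigma>" "\<lambda>_. 1", OF fires_le_1] by (simp add: deg_def)

lemma chip_step_balance:
  "chip_step E \<sigma> v + deg E v * fires E \<sigma> v = \<sigma> v + (\<Sum>w\<in>E `` {v}. fires E \<sigma> w)"
  by (simp add: chip_step_def fires_def)

text \<open>A vertex gains at most its degree in a round; if it fires it also loses its degree, and
  if not it starts below its degree.\<close>

lemma chip_step_confined: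
  assumes "\<sigma> v < 2 * deg E v"
  shows "chip_step E \<sigma> v < 2 * deg E v"
  using chip_step_balance[of E \<sigma> v] sum_fires_le_deg[of E \<sigma> v] assms
  by (auto simp: fires_def split: if_splits)

lemma chip_step_le:
  assumes "\<sigma> v \<ge> deg E v"
  shows "chip_step E \<sigma> v \<le> \<sigma> v"
  using chip_step_balance[of E \<sigma> v] sum_fires_le_deg[of E \<sigma> v] assms
  by (simp add: fires_def)

lemma neighbours_fire:
  assumes "finite (E `` {v})" and "\<sigma> v \<ge> deg E v" and "chip_step E \<sigma> v \<ge> \<sigma> v"
    and w: "(v, w) \<in> E"
  shows "\<sigma> w \<ge> deg E w"
proof (rule ccontr)
  assume "\<not> \<sigma> w \<ge> deg E w"
  then have "(\<Sum>w\<in>E `` {v}. fires E \<sigma> w) < (\<Sum>w\<in>E `` {v}. 1)"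
    using assms(1) w by (intro sum_strict_mono_ex1) (auto simp: fires_le_1 fires_def)
  then show False
    using chip_step_balance[of E \<sigma> v] assms(2,3) by (simp add: fires_def deg_def)
qed

lemma confined_from:
  assumes "((chip_step E ^^ s) \<sigma>) v < 2 * deg E v" and "s \<le> t"
  shows "((chip_step E ^^ t) \<sigma>) v < 2 * deg E v"
  using assms(2,1) by (induction t rule: dec_induct) (auto simp: chip_step_confined)

text \<open>A vertex that fires in every round never gains chips on balance, so its chip count is
  eventually constant. From then on it recovers its full degree each round, which requires all
  neighbours to fire.\<close>

lemma always_firing_neighbours:
  assumes fin: "finite (E `` {v})"
    and full: "\<And>t. t \<ge> s \<Longrightarrow> ((chip_step E ^^ t) \<sigma>) v \<ge> deg E v"
  obtains s' where "s' \<ge> s" "\<And>t w. t \<ge> s' \<Longrightarrow> (v, w) \<in> E \<Longrightarrow> ((chip_step E ^^ t) \<sigma>) w \<ge> deg E w"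
proof -
  define c where "c t = ((chip_step E ^^ t) \<sigma>) v" for t
  obtain s' where s': "s' \<ge> s" "\<And>t. t \<ge> s \<Longrightarrow> c s' \<le> c t"
    using ex_has_least_nat[of "\<lambda>t. t \<ge> s" s c] by auto
  have le: "c (Suc t) \<le> c t" if "t \<ge> s" for t
    using chip_step_le full[OF that] by (simp add: c_def)
  have "c t \<le> c s'" if "t \<ge> s'" for t
    using that by (induction t rule: dec_induct) (use le s'(1) in \<open>auto intro: order_trans\<close>)
  then have "c t \<le> c (Suc t)" if "t \<ge> s'" for t
    using s' that by (meson le_Suc_eq le_trans)
  then have "\<And>t w. t \<ge> s' \<Longrightarrow> (v, w) \<in> E \<Longrightarrow> ((chip_step E ^^ t) \<sigma>) w \<ge> deg E w"
    using neighbours_fire[OF fin] full s'(1) by (auto simp: c_def)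
  then show ?thesis using that s'(1) by blast
qed

section \<open>Firing counts (the odometer)\<close>

definition fire_count :: "('v \<times> 'v) set \<Rightarrow> 'v config \<Rightarrow> nat \<Rightarrow> 'v \<Rightarrow> nat" where
  "fire_count E \<sigma> t v = (\<Sum>s<t. fires E ((chip_step E ^^ s) \<sigma>) v)"

lemma fire_count_balance:
  "((chip_step E ^^ t) \<sigma>) v + deg E v * fire_count E \<sigma> t v
     = \<sigma> v + (\<Sum>w\<in>E `` {v}. fire_count E \<sigma> t w)"
proof (induction t)
  case 0
  then show ?case by (simp add: fire_count_def)
next
  case (Suc t)
  then show ?case
    using chip_step_balance[of E "(chip_step E ^^ t) \<sigma>" v]
    by (simp add: fire_count_def sum.distrib algebra_simps)
qed

text \<open>In the balance equation the current chip count is the remainder term. Being below twice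
  the degree, its quotient by the degree is 1 or 0 according to whether the vertex fires now, so
  division counts this firing as well.\<close>

lemma fire_count_Suc:
  assumes "\<sigma> v < 2 * deg E v"
  shows "fire_count E \<sigma> (Suc t) v = (\<sigma> v + (\<Sum>w\<in>E `` {v}. fire_count E \<sigma> t w)) div deg E v"
proof -
  let ?c = "((chip_step E ^^ t) \<sigma>) v"
  have "?c < 2 * deg E v"
    using confined_from[of 0 E \<sigma> v t] assms by simp
  then have "?c div deg E v = fires E ((chip_step E ^^ t) \<sigma>) v"
    by (auto simp: fires_def div_nat_eqI)
  then have "(?c + deg E v * fire_count E \<sigma> t v) div deg E v = fire_count E \<sigma> (Suc t) v"
    using assms by (simp add: fire_count_def)
  then show ?thesis by (simp add: fire_count_balance)
qed

section \<open>Complete bipartite graphs\<close>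

lemma neighbours_Inl: "i \<in> {1..a} \<Longrightarrow> K_edges a b `` {Inl i} = Inr ` {1..b}"
  by (auto simp: K_edges_def)

lemma neighbours_Inr: "j \<in> {1..b} \<Longrightarrow> K_edges a b `` {Inr j} = Inl ` {1..a}"
  by (auto simp: K_edges_def)

lemma sum_neighbours_Inl:
  "i \<in> {1..a} \<Longrightarrow> (\<Sum>w\<in>K_edges a b `` {Inl i}. F w) = (\<Sum>j\<in>{1..b}. F (Inr j))"
  by (simp only: neighbours_Inl) (simp add: sum.reindex)

lemma sum_neighbours_Inr:
  "j \<in> {1..b} \<Longrightarrow> (\<Sum>w\<in>K_edges a b `` {Inr j}. F w) = (\<Sum>i\<in>{1..a}. F (Inl i))"
  by (simp only: neighbours_Inr) (simp add: sum.reindex)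

section \<open>Conservation of chips and the two thresholds\<close>

lemma total_chips_K:
  "total_chips (K_verts a b) \<sigma> = (\<Sum>i\<in>{1..a}. \<sigma> (Inl i)) + (\<Sum>j\<in>{1..b}. \<sigma> (Inr j))"
  by (simp add: total_chips_def K_verts_def sum.Plus)

lemma total_chips_chip_step:
  "total_chips (K_verts a b) (chip_step (K_edges a b) \<sigma>) = total_chips (K_verts a b) \<sigma>"
proof -
  let ?E = "K_edges a b"
  define l where "l = (\<Sum>i\<in>{1..a}. fires ?E \<sigma> (Inl i))"
  define r where "r = (\<Sum>j\<in>{1..b}. fires ?E \<sigma> (Inr j))"
  have "(\<Sum>i\<in>{1..a}. chip_step ?E \<sigma> (Inl i)) + b * l
      = (\<Sum>i\<in>{1..a}. chip_step ?E \<sigma> (Inl i) + deg ?E (Inl i) * fires ?E \<sigma> (Inl i))"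
    by (simp add: sum.distrib deg_K_Inl l_def sum_distrib_left)
  also have "\<dots> = (\<Sum>i\<in>{1..a}. \<sigma> (Inl i) + r)"
    by (intro sum.cong refl) (simp only: chip_step_balance sum_neighbours_Inl r_def)
  finally have L: "(\<Sum>i\<in>{1..a}. chip_step ?E \<sigma> (Inl i)) + b * l = (\<Sum>i\<in>{1..a}. \<sigma> (Inl i)) + a * r"
    by (simp add: sum.distrib)
  have "(\<Sum>j\<in>{1..b}. chip_step ?E \<sigma> (Inr j)) + a * r
      = (\<Sum>j\<in>{1..b}. chip_step ?E \<sigma> (Inr j) + deg ?E (Inr j) * fires ?E \<sigma> (Inr j))"
    by (simp add: sum.distrib deg_K_Inr r_def sum_distrib_left)
  also have "\<dots> = (\<Sum>j\<in>{1..b}. \<sigma> (Inr j) + l)"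
    by (intro sum.cong refl) (simp only: chip_step_balance sum_neighbours_Inr l_def)
  finally have R: "(\<Sum>j\<in>{1..b}. chip_step ?E \<sigma> (Inr j)) + a * r = (\<Sum>j\<in>{1..b}. \<sigma> (Inr j)) + b * l"
    by (simp add: sum.distrib)
  show ?thesis using L R by (simp add: total_chips_K)
qed

lemma total_chips_iterate:
  "total_chips (K_verts a b) ((chip_step (K_edges a b) ^^ t) \<sigma>) = total_chips (K_verts a b) \<sigma>"
  by (induction t) (simp_all add: total_chips_chip_step)

text \<open>The degrees add up to \<open>2 * a * b\<close>. With the next lemma, strictly between
  the two thresholds some vertex fires and some vertex does not.\<close>

lemma total_chips_all_fire:
  assumes "\<And>v. v \<in> K_verts a b \<Longrightarrow> deg (K_edges a b) v \<le> \<sigma> v"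
  shows "2 * a * b \<le> total_chips (K_verts a b) \<sigma>"
proof -
  have "(\<Sum>i\<in>{1..a}. b) \<le> (\<Sum>i\<in>{1..a}. \<sigma> (Inl i))"
    using assms deg_K_Inl by (intro sum_mono) (force simp: K_verts_def)
  moreover have "(\<Sum>j\<in>{1..b}. a) \<le> (\<Sum>j\<in>{1..b}. \<sigma> (Inr j))"
    using assms deg_K_Inr by (intro sum_mono) (force simp: K_verts_def)
  ultimately show ?thesis by (simp add: total_chips_K algebra_simps)
qed

lemma total_chips_none_fires:
  assumes "\<And>v. v \<in> K_verts a b \<Longrightarrow> \<sigma> v < deg (K_edges a b) v"
  shows "total_chips (K_verts a b) \<sigma> + a + b \<le> 2 * a * b"
proof -
  have "(\<Sum>i\<in>{1..a}. \<sigma> (Inl i) + 1) \<le> (\<Sum>i\<in>{1..a}. b)"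
    using assms deg_K_Inl by (intro sum_mono) (force simp: K_verts_def Suc_le_eq)
  moreover have "(\<Sum>j\<in>{1..b}. \<sigma> (Inr j) + 1) \<le> (\<Sum>j\<in>{1..b}. a)"
    using assms deg_K_Inr by (intro sum_mono) (force simp: K_verts_def Suc_le_eq)
  ultimately have "(\<Sum>i\<in>{1..a}. \<sigma> (Inl i)) + a \<le> a * b" "(\<Sum>j\<in>{1..b}. \<sigma> (Inr j)) + b \<le> b * a"
    by (simp_all only: sum.distrib) simp_all
  then show ?thesis by (simp add: total_chips_K algebra_simps)
qed

section \<open>Confinement, fixed points and period two\<close>

lemma chip_iterate_K_outside:
  "v \<notin> K_verts a b \<Longrightarrow> (chip_step (K_edges a b) ^^ t) \<sigma> v = \<sigma> v"
  by (induction t) (simp_all add: chip_step_K_outside)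

lemma finite_neighbours_K: "finite (K_edges a b `` S)"
  by (rule finite_subset[of _ "K_verts a b"]) (auto simp: K_edges_def K_verts_def)

text \<open>Any neighbour \<open>w\<close> will do: \<open>v\<close> sees the opposite side and
  \<open>w\<close> sees the side of \<open>v\<close>. Firing thus spreads from one vertex to all in
  two moves along edges.\<close>

lemma dominating_edge_K:
  assumes "a \<ge> 1" and "b \<ge> 1" and "v \<in> K_verts a b"
  obtains w where "(v, w) \<in> K_edges a b"
    and "\<And>u. u \<in> K_verts a b \<Longrightarrow> (v, u) \<in> K_edges a b \<or> (w, u) \<in> K_edges a b"
proof (cases v)
  case (Inl i)
  show ?thesis
    by (rule that[of "Inr 1"]) (use assms Inl in \<open>auto simp: K_edges_def K_verts_def\<close>)
next
  case (Inr j)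
  show ?thesis
    by (rule that[of "Inl 1"]) (use assms Inr in \<open>auto simp: K_edges_def K_verts_def\<close>)
qed

text \<open>A vertex that always holds twice its degree fires forever. Then its neighbours
  eventually fire forever, and in turn the neighbours of its partner on a dominating edge; at that
  time all vertices fire, which takes at least \<open>2 * a * b\<close> chips.\<close>

lemma eventually_confined:
  assumes ab: "a \<ge> 1" "b \<ge> 1" and total: "total_chips (K_verts a b) \<sigma> < 2 * a * b"
  obtains T where "\<And>v. v \<in> K_verts a b \<Longrightarrow> ((chip_step (K_edges a b) ^^ T) \<sigma>) v < 2 * deg (K_edges a b) v"
proof -
  let ?E = "K_edges a b"
  let ?c = "\<lambda>t. (chip_step ?E ^^ t) \<sigma>"
  have conf: "\<exists>t. ?c t v < 2 * deg ?E v" if v: "v \<in> K_verts a b" for v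
  proof (rule ccontr)
    assume "\<not> ?thesis"
    then have "2 * deg ?E v \<le> ?c t v" for t
      by (simp add: not_less)
    then have "deg ?E v \<le> ?c t v" for t
      by (rule order_trans[rotated]) simp
    then obtain s where s: "\<And>t w. t \<ge> s \<Longrightarrow> (v, w) \<in> ?E \<Longrightarrow> deg ?E w \<le> ?c t w"
      using always_firing_neighbours[OF finite_neighbours_K, of 0] by metis
    obtain w where w: "(v, w) \<in> ?E" "\<And>u. u \<in> K_verts a b \<Longrightarrow> (v, u) \<in> ?E \<or> (w, u) \<in> ?E"
      using dominating_edge_K[OF ab v] by blast
    then obtain s' where s': "s' \<ge> s" "\<And>t u. t \<ge> s' \<Longrightarrow> (w, u) \<in> ?E \<Longrightarrow> deg ?E u \<le> ?c t u"
      using always_firing_neighbours[OF finite_neighbours_K, of s] s by metis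
    have "2 * a * b \<le> total_chips (K_verts a b) (?c s')"
    proof (rule total_chips_all_fire)
      fix u assume "u \<in> K_verts a b"
      then show "deg ?E u \<le> ?c s' u" using w(2)[of u] s[of s' u] s'(1) s'(2)[of s' u] by blast
    qed
    then show False using total by (simp add: total_chips_iterate)
  qed
  have "\<forall>v\<in>K_verts a b. \<forall>\<^sub>F t in sequentially. ?c t v < 2 * deg ?E v"
  proof
    fix v assume "v \<in> K_verts a b"
    then obtain s where s: "?c s v < 2 * deg ?E v" using conf by blast
    show "\<forall>\<^sub>F t in sequentially. ?c t v < 2 * deg ?E v"
      using eventually_ge_at_top[of s] by eventually_elim (rule confined_from[OF s])
  qed
  then have "\<forall>\<^sub>F t in sequentially. \<forall>v\<in>K_verts a b. ?c t v < 2 * deg ?E v"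
    by (intro eventually_ball_finite) (simp_all add: K_verts_def)
  then show ?thesis
    using that by (auto simp: eventually_sequentially)
qed

text \<open>In a fixed configuration a firing vertex forces its neighbours to fire, so all vertices
  fire or none does; the thresholds exclude both.\<close>

lemma not_fixed:
  assumes ab: "a \<ge> 1" "b \<ge> 1"
    and lo: "2 * a * b < total_chips (K_verts a b) \<sigma> + a + b"
    and hi: "total_chips (K_verts a b) \<sigma> < 2 * a * b"
  shows "chip_step (K_edges a b) \<sigma> \<noteq> \<sigma>"
proof
  let ?E = "K_edges a b"
  assume fixed: "chip_step ?E \<sigma> = \<sigma>"
  have one: "deg ?E w \<le> \<sigma> w" if "deg ?E v \<le> \<sigma> v" "(v, w) \<in> ?E" for v w
    using neighbours_fire[OF finite_neighbours_K _ _ that(2), of \<sigma>] that(1) fixed by simp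
  show False
  proof (cases "\<exists>v\<in>K_verts a b. deg ?E v \<le> \<sigma> v")
    case True
    then obtain v w where "deg ?E v \<le> \<sigma> v" "(v, w) \<in> ?E"
      "\<And>u. u \<in> K_verts a b \<Longrightarrow> (v, u) \<in> ?E \<or> (w, u) \<in> ?E"
      using dominating_edge_K[OF ab] by metis
    then have "\<And>u. u \<in> K_verts a b \<Longrightarrow> deg ?E u \<le> \<sigma> u" using one by blast
    then show False using total_chips_all_fire[of a b \<sigma>] hi by simp
  next
    case False
    then show False using total_chips_none_fires[of a b \<sigma>] lo by (simp add: not_le)
  qed
qed

text \<open>Once \<open>A\<close> and \<open>B\<close> grow by \<open>b\<close> and \<open>a\<close>
  over two rounds, every floor grows by one: each vertex fires once and receives exactly its degree,
  so the balance equation restores its chips.\<close>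

lemma confined_two_periodic:
  assumes ab: "a \<ge> 1" "b \<ge> 1"
    and lo: "2 * a * b < total_chips (K_verts a b) \<sigma> + a + b"
    and hi: "total_chips (K_verts a b) \<sigma> < 2 * a * b"
    and conf: "\<And>v. v \<in> K_verts a b \<Longrightarrow> \<sigma> v < 2 * deg (K_edges a b) v"
  shows "\<forall>\<^sub>F t in sequentially. (chip_step (K_edges a b) ^^ (t + 2)) \<sigma> = (chip_step (K_edges a b) ^^ t) \<sigma>"
proof -
  let ?E = "K_edges a b"
  define u where "u = fire_count ?E \<sigma>"
  define A where "A t = (\<Sum>j\<in>{1..b}. u t (Inr j))" for t
  define B where "B t = (\<Sum>i\<in>{1..a}. u t (Inl i))" for t
  define f where "f x = (\<Sum>i\<in>{1..a}. (\<sigma> (Inl i) + x) div b)" for x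
  define g where "g y = (\<Sum>j\<in>{1..b}. (\<sigma> (Inr j) + y) div a)" for y
  have conf_Inl: "\<sigma> (Inl i) < 2 * b" if "i \<in> {1..a}" for i
    using that conf deg_K_Inl unfolding K_verts_def by (metis InlI)
  have conf_Inr: "\<sigma> (Inr j) < 2 * a" if "j \<in> {1..b}" for j
    using that conf deg_K_Inr unfolding K_verts_def by (metis InrI)
  have uL: "u (Suc t) (Inl i) = (\<sigma> (Inl i) + A t) div b" if "i \<in> {1..a}" for t i
    using fire_count_Suc[of \<sigma> "Inl i" ?E t] conf_Inl[of i] that
    by (simp add: u_def A_def sum_neighbours_Inl deg_K_Inl)
  have uR: "u (Suc t) (Inr j) = (\<sigma> (Inr j) + B t) div a" if "j \<in> {1..b}" for t j
    using fire_count_Suc[of \<sigma> "Inr j" ?E t] conf_Inr[of j] that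
    by (simp add: u_def B_def sum_neighbours_Inr deg_K_Inr)
  have B_Suc: "B (Suc t) = f (A t)" for t by (simp add: B_def f_def uL)
  have A_Suc: "A (Suc t) = g (B t)" for t by (simp add: A_def g_def uR)
  have mf: "mono f" unfolding f_def by (intro monoI sum_mono div_le_mono) simp
  have mg: "mono g" unfolding g_def by (intro monoI sum_mono div_le_mono) simp
  have pf: "f (x + b) = f x + a" for x
    using ab by (simp add: f_def sum_Suc flip: add.assoc)
  have pg: "g (y + a) = g y + b" for y
    using ab by (simp add: g_def sum_Suc flip: add.assoc)
  have "(\<Sum>x<b. f x) = (\<Sum>i\<in>{1..a}. \<Sum>x<b. (\<sigma> (Inl i) + x) div b)"
    unfolding f_def by (rule sum.swap)
  moreover have "(\<Sum>y<a. g y) = (\<Sum>j\<in>{1..b}. \<Sum>y<a. (\<sigma> (Inr j) + y) div a)"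
    unfolding g_def by (rule sum.swap)
  ultimately have total: "(\<Sum>x<b. f x) + (\<Sum>y<a. g y) = total_chips (K_verts a b) \<sigma>"
    using ab by (simp add: sum_div_shift_eq total_chips_K)
  define h where "h x = g (f x)" for x
  have mh: "mono h" using mf mg by (simp add: mono_def h_def)
  have ph: "h (x + b) = h x + b" for x by (simp add: h_def pf pg)
  obtain z where z: "h z = z + b"
  proof (rule translation_trichotomy[OF mh ph ab(2)])
    assume "\<And>x. x + b < h x"
    then show ?thesis using translation_lower_bound[OF mf mg pf pg] total hi by (simp add: h_def)
  next
    assume "\<And>x. h x < x + b"
    then show ?thesis using translation_upper_bound[OF mf mg pf pg] total lo by (simp add: h_def)
  qed
  have A_step: "A (t + 2) = h (A t)" for t
    by (simp add: A_Suc B_Suc h_def numeral_2_eq_2)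
  have persist: "A (s + 2 * k + 2) = A (s + 2 * k) + b" if "A (s + 2) = A s + b" for s k
  proof (induction k)
    case (Suc k)
    then have "h (A (s + 2 * k + 2)) = h (A (s + 2 * k)) + b" using ph by simp
    then show ?case using A_step[of "s + 2 * k"] A_step[of "s + 2 * k + 2"] by simp
  qed (use that in simp)
  \<comment> \<open>\<open>h\<close> advances time by two, so even and odd times form separate
    orbits, each of which has to lock.\<close>
  have lock: "\<exists>n. A (2 * n + e + 2) = A (2 * n + e) + b" for e
    using translation_orbit_locks[OF mh ph ab(2) z, of "\<lambda>n. A (2 * n + e)"] A_step
    by (metis (no_types, lifting) add.assoc add.commute mult_Suc_right)
  obtain n0 n1 where n: "A (2 * n0 + 2) = A (2 * n0) + b" "A (2 * n1 + 1 + 2) = A (2 * n1 + 1) + b"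
    using lock[of 0] lock[of 1] by auto
  have A_per: "A (t + 2) = A t + b" if "t \<ge> 2 * n0 + 2 * n1 + 1" for t
  proof (cases "even t")
    case True
    then have "t = 2 * n0 + 2 * (t div 2 - n0)" using that by auto
    then show ?thesis using persist[OF n(1)] by metis
  next
    case False
    then have "t = 2 * n1 + 1 + 2 * (t div 2 - n1)" using that by (auto elim!: oddE)
    then show ?thesis using persist[OF n(2)] by metis
  qed
  define N where "N = 2 * n0 + 2 * n1 + 1"
  have B_per: "B (Suc t + 2) = B (Suc t) + a" if "t \<ge> N" for t
    using A_per[of t] that B_Suc[of t] B_Suc[of "t + 2"] pf by (simp add: N_def)
  have "(chip_step ?E ^^ (t + 2)) \<sigma> = (chip_step ?E ^^ t) \<sigma>" if "t \<ge> N + 2" for t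
  proof
    fix v
    \<comment> \<open>Firing counts at \<open>t\<close> depend on \<open>A\<close> and
      \<open>B\<close> at \<open>s = t - 1\<close>, and the growth of \<open>B\<close> at
      \<open>s\<close> on that of \<open>A\<close> at \<open>s' = t - 2\<close>; hence the margin of
      2 beyond \<open>N\<close>.\<close>
    define s' where "s' = t - 2"
    define s where "s = Suc s'"
    have s': "s = Suc s'" "s' \<ge> N" and s: "t = Suc s" "s \<ge> Suc N"
      using that by (simp_all add: s_def s'_def)
    note bal = fire_count_balance[of "t + 2" ?E \<sigma> v] fire_count_balance[of t ?E \<sigma> v]
    consider i where "v = Inl i" "i \<in> {1..a}" | j where "v = Inr j" "j \<in> {1..b}"
      | "v \<notin> K_verts a b"
      unfolding K_verts_def by blast
    then show "(chip_step ?E ^^ (t + 2)) \<sigma> v = (chip_step ?E ^^ t) \<sigma> v"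
    proof cases
      case 1
      have "u (t + 2) v = (\<sigma> v + A (s + 2)) div b" using uL[of i "s + 2"] 1 s by simp
      also have "\<dots> = (\<sigma> v + A s) div b + 1"
        using A_per[of s] s ab by (simp add: N_def flip: add.assoc)
      also have "\<dots> = u t v + 1" using uL[of i s] 1 s by simp
      finally have "u (t + 2) v = u t v + 1" .
      moreover have "A (t + 2) = A t + b" using A_per[of t] that by (simp add: N_def)
      ultimately show ?thesis
        using bal 1 by (simp add: sum_neighbours_Inl deg_K_Inl A_def flip: u_def)
    next
      case 2
      have "u (t + 2) v = (\<sigma> v + B (s + 2)) div a" using uR[of j "s + 2"] 2 s by simp
      also have "\<dots> = (\<sigma> v + B s) div a + 1"
        using B_per[of s'] s' ab by (simp flip: add.assoc)
      also have "\<dots> = u t v + 1" using uR[of j s] 2 s by simp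
      finally have "u (t + 2) v = u t v + 1" .
      moreover have "B (t + 2) = B t + a" using B_per[of s] s by simp
      ultimately show ?thesis
        using bal 2 by (simp add: sum_neighbours_Inr deg_K_Inr B_def flip: u_def)
    next
      \<comment> \<open>Configurations are compared as total functions, so points outside the graph
        count too.\<close>
      case 3
      then show ?thesis by (metis chip_iterate_K_outside)
    qed
  qed
  then show ?thesis unfolding eventually_sequentially by blast
qed

theorem theorem1:
  fixes a b :: nat and \<sigma> :: "(nat + nat) config"
  assumes "a \<ge> 1" and "b \<ge> 1"
    and "2 * int a * int b - int a - int b < int (total_chips (K_verts a b) \<sigma>)"
    and "int (total_chips (K_verts a b) \<sigma>) < 2 * int a * int b"
  shows "eventual_period (K_edges a b) \<sigma> = 2"
proof -
  let ?E = "K_edges a b"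
  \<comment> \<open>Moving \<open>a + b\<close> to the other side lets the lower threshold be stated
    over the naturals without truncated subtraction.\<close>
  have "int (2 * a * b) < int (total_chips (K_verts a b) \<sigma> + a + b)"
    "int (total_chips (K_verts a b) \<sigma>) < int (2 * a * b)"
    using assms(3,4) by simp_all
  then have lo: "2 * a * b < total_chips (K_verts a b) \<sigma> + a + b"
    and hi: "total_chips (K_verts a b) \<sigma> < 2 * a * b"
    by (simp_all only: of_nat_less_iff)
  obtain T where T: "\<And>v. v \<in> K_verts a b \<Longrightarrow> ((chip_step ?E ^^ T) \<sigma>) v < 2 * deg ?E v"
    using eventually_confined[OF assms(1,2) hi] by blast
  have "\<forall>\<^sub>F t in sequentially. (chip_step ?E ^^ (t + 2)) ((chip_step ?E ^^ T) \<sigma>)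
      = (chip_step ?E ^^ t) ((chip_step ?E ^^ T) \<sigma>)"
    using lo hi T by (intro confined_two_periodic assms(1,2)) (simp_all add: total_chips_iterate)
  then have "\<forall>\<^sub>F t in sequentially. (chip_step ?E ^^ (t + T + 2)) \<sigma> = (chip_step ?E ^^ (t + T)) \<sigma>"
    by (simp add: funpow_add add.commute add.left_commute)
  then have two: "\<forall>\<^sub>F t in sequentially. (chip_step ?E ^^ (t + 2)) \<sigma> = (chip_step ?E ^^ t) \<sigma>"
    by (rule eventually_sequentially_seg[THEN iffD1, rotated])
  \<comment> \<open>Period 1 would make some iterate a fixed configuration with the same number of
    chips.\<close>
  have not_one: "\<not> (\<forall>\<^sub>F t in sequentially. (chip_step ?E ^^ (t + 1)) \<sigma> = (chip_step ?E ^^ t) \<sigma>)"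
    using not_fixed[OF assms(1,2)] lo hi
    by (auto simp: eventually_sequentially total_chips_iterate)
  show ?thesis
    unfolding eventual_period_def
  proof (rule Least_equality)
    fix p assume "p \<ge> 1 \<and> (\<forall>\<^sub>F t in sequentially. (chip_step ?E ^^ (t + p)) \<sigma> = (chip_step ?E ^^ t) \<sigma>)"
    then show "2 \<le> p" using not_one by (cases "p = 1") auto
  qed (use two in simp)
qed

end
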